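(* Let $G$ be a Polish group which has Bergman's property and has a comeagre conjugacy class. Then every (abstract) group homomorphism from $G$ into a locally compact $\sigma$-compact (Hausdorff) topological group is trivial.
   Context: A group $F$ has Bergman's property if whenever $W_0\subseteq W_1\subseteq\cdots\subseteq F$ is an increasing sequence of subsets with $\bigcup_n W_n=F$, there are $n$ and $k$ with $F=W_n^k$. A conjugacy class is comeagre if its complement is meagre in $G$. *)

theory Defs
  imports "HOL-Analysis.Analysis" "HOL-Algebra.Coset"
begin

locale topological_group = group G for G (structure) +
  fixes T :: "'a topology"
  assumes topspace_eq_carrier: "topspace T = carrier G"
    and continuous_mult: "continuous_map (prod_topology T T) T (\<lambda>(x, y). x \<otimes> y)"
    and continuous_inv: "continuous_map T T (\<lambda>x. inv x)"

definition polish_topology :: "'a topology \<Rightarrow> bool" where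
  "polish_topology T \<longleftrightarrow> separable_space T \<and> completely_metrizable_space T"

definition sigma_compact_space :: "'a topology \<Rightarrow> bool" where
  "sigma_compact_space T \<longleftrightarrow>
     (\<exists>K :: nat \<Rightarrow> 'a set. (\<forall>n. compactin T (K n)) \<and> (\<Union>n. K n) = topspace T)"

definition nowhere_dense_in :: "'a topology \<Rightarrow> 'a set \<Rightarrow> bool" where
  "nowhere_dense_in T A \<longleftrightarrow> A \<subseteq> topspace T \<and> T interior_of (T closure_of A) = {}"

definition meagre_in :: "'a topology \<Rightarrow> 'a set \<Rightarrow> bool" where
  "meagre_in T A \<longleftrightarrow>
     (\<exists>N :: nat \<Rightarrow> 'a set. (\<forall>n. nowhere_dense_in T (N n)) \<and> A = (\<Union>n. N n))"

definition comeagre_in :: "'a topology \<Rightarrow> 'a set \<Rightarrow> bool" where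
  "comeagre_in T A \<longleftrightarrow> A \<subseteq> topspace T \<and> meagre_in T (topspace T - A)"

definition conjugacy_class :: "('a, 'b) monoid_scheme \<Rightarrow> 'a \<Rightarrow> 'a set" where
  "conjugacy_class G x = {g \<otimes>\<^bsub>G\<^esub> x \<otimes>\<^bsub>G\<^esub> inv\<^bsub>G\<^esub> g | g. g \<in> carrier G}"

primrec set_power :: "('a, 'b) monoid_scheme \<Rightarrow> 'a set \<Rightarrow> nat \<Rightarrow> 'a set" where
  "set_power G W 0 = {\<one>\<^bsub>G\<^esub>}"
| "set_power G W (Suc k) = set_power G W k <#>\<^bsub>G\<^esub> W"

definition bergman_property :: "('a, 'b) monoid_scheme \<Rightarrow> bool" where
  "bergman_property G \<longleftrightarrow>
     (\<forall>W :: nat \<Rightarrow> 'a set. (\<forall>n. W n \<subseteq> W (Suc n)) \<and> (\<Union>n. W n) = carrier G \<longrightarrow>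
        (\<exists>n k. carrier G = set_power G (W n) k))"

end

(*
  By Bergman's property the image of \<phi> lies in a compact power of a compact set, so its
  closure L is compact. Let C be the comeagre class of x; then \<phi>(C) \<subseteq> K = {h
  \<phi>(x) h^-1 | h \<in> L}, a compact set. By the Baire category theorem, for finitely many
  g_1, ..., g_n there is c with g_1 c, ..., g_n c \<in> C. Hence, by compactness of L, there is c
  \<in> L with \<phi>(g) c \<in> K for all g, so that L c \<subseteq> K. As c^-1 \<in> L, this
  gives 1 \<in> K, so \<phi>(x) = 1 and K = {1}; now \<phi>(g) c = 1 for every g, which forces
  \<phi> to be trivial.
*)

theory Submission
  imports Defs
begin

text \<open>Baire category theorem: the closures of all the nowhere dense pieces form one countable
  family of closed sets with empty interior, so their union has empty interior and cannot cover a
  nonempty space.\<close>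

lemma countable_meagre_avoid_point:
  fixes S :: "'a topology" and M :: "'b \<Rightarrow> 'a set"
  assumes "completely_metrizable_space S" "countable I"
    and "\<And>i. i \<in> I \<Longrightarrow> meagre_in S (M i)"
    and "topspace S \<noteq> {}"
  shows "\<exists>x \<in> topspace S. \<forall>i\<in>I. x \<notin> M i"
proof -
  obtain N :: "'b \<Rightarrow> nat \<Rightarrow> 'a set"
    where N: "\<And>i n. i \<in> I \<Longrightarrow> nowhere_dense_in S (N i n)"
      and M: "\<And>i. i \<in> I \<Longrightarrow> M i = (\<Union>n. N i n)"
    using assms(3) unfolding meagre_in_def by metis
  define \<G> where "\<G> = (\<lambda>(i, n). S closure_of N i n) ` (I \<times> (UNIV :: nat set))"
  have "S interior_of \<Union>\<G> = {}"
  proof (rule Baire_category_alt)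
    show "countable \<G>"
      using assms(2) by (simp add: \<G>_def)
    show "closedin S A \<and> S interior_of A = {}" if "A \<in> \<G>" for A
      using that N by (auto simp: \<G>_def nowhere_dense_in_def)
  qed (use assms(1) in blast)
  then have "\<not> topspace S \<subseteq> \<Union>\<G>"
    using assms(4) interior_of_mono[of "topspace S" "\<Union>\<G>" S] by auto
  moreover have "M i \<subseteq> \<Union>\<G>" if "i \<in> I" for i
  proof -
    have "N i n \<subseteq> S closure_of N i n" for n
      using N[OF that, of n] by (simp add: nowhere_dense_in_def closure_of_subset)
    then show ?thesis
      using that by (fastforce simp: M \<G>_def)
  qed
  ultimately show ?thesis
    by blast
qed

lemma homeomorphic_map_meagre_in:
  fixes A :: "'a set"
  assumes f: "homeomorphic_map X Y f" and A: "meagre_in X A"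
  shows "meagre_in Y (f ` A)"
proof -
  obtain N :: "nat \<Rightarrow> 'a set" where N: "\<forall>n. nowhere_dense_in X (N n)" and A_eq: "A = (\<Union>n. N n)"
    using A unfolding meagre_in_def by blast
  have "nowhere_dense_in Y (f ` N n)" for n
  proof -
    have "N n \<subseteq> topspace X" "X interior_of (X closure_of N n) = {}"
      using N by (auto simp: nowhere_dense_in_def)
    then show ?thesis
      using homeomorphic_imp_surjective_map[OF f]
      unfolding nowhere_dense_in_def
      by (metis homeomorphic_map_closure_of[OF f] homeomorphic_map_interior_of[OF f]
          closure_of_subset_topspace image_empty image_mono)
  qed
  moreover have "f ` A = (\<Union>n. f ` N n)"
    unfolding A_eq by (rule image_UN)
  ultimately show ?thesis
    unfolding meagre_in_def by (intro exI[of _ "\<lambda>n. f ` N n"]) simp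
qed

text \<open>Finite intersection property of a compact set, phrased with indices so that it can be
  applied to sets \<open>D g\<close> indexed by group elements.\<close>

lemma compactin_fip_indexed:
  assumes L: "compactin T L"
    and closed: "\<And>i. i \<in> I \<Longrightarrow> closedin T (D i)"
    and fip: "\<And>A. finite A \<Longrightarrow> A \<subseteq> I \<Longrightarrow> \<exists>x \<in> L. \<forall>i\<in>A. x \<in> D i"
  shows "\<exists>x \<in> L. \<forall>i\<in>I. x \<in> D i"
proof -
  have "L \<inter> \<Inter>\<F> \<noteq> {}" if \<F>: "finite \<F>" "\<F> \<subseteq> D ` I" for \<F>
  proof -
    obtain A where "finite A" "A \<subseteq> I" "\<F> = D ` A"
      using finite_subset_image[OF \<F>] by blast
    then show ?thesis
      using fip[of A] by fastforce
  qed
  then have "L \<inter> \<Inter>(D ` I) \<noteq> {}"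
    using L closed by (simp add: compactin_fip)
  then show ?thesis
    by blast
qed

context topological_group
begin

lemma continuous_map_mult [continuous_intros]:
  assumes "continuous_map X T f" "continuous_map X T g"
  shows "continuous_map X T (\<lambda>x. f x \<otimes> g x)"
  using continuous_map_compose[OF continuous_map_pairedI[OF assms] continuous_mult]
  by (simp add: o_def)

lemma continuous_map_inv [continuous_intros]:
  assumes "continuous_map X T f"
  shows "continuous_map X T (\<lambda>x. inv (f x))"
  using continuous_map_compose[OF assms continuous_inv] by (simp add: o_def)

lemma homeomorphic_map_left_mult:
  assumes "a \<in> carrier G"
  shows "homeomorphic_map T T (\<lambda>x. a \<otimes> x)"
proof -
  have "homeomorphic_maps T T (\<lambda>x. a \<otimes> x) (\<lambda>x. inv a \<otimes> x)"
    unfolding homeomorphic_maps_def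
    using assms
    by (auto simp: topspace_eq_carrier m_assoc[symmetric] intro!: continuous_intros)
  then show ?thesis
    using homeomorphic_maps_map by blast
qed

lemma compactin_set_power:
  assumes "compactin T K"
  shows "compactin T (set_power G K k)"
proof (induction k)
  case 0
  then show ?case
    by (simp add: topspace_eq_carrier)
next
  case (Suc k)
  have "set_power G K k <#> K = (\<lambda>(x, y). x \<otimes> y) ` (set_power G K k \<times> K)"
    unfolding set_mult_def by auto
  then show ?case
    using image_compactin[OF _ continuous_mult] Suc assms by (simp add: compactin_Times)
qed

text \<open>The condition on \<open>c\<close> says that it lies in every translate
  \<open>inv a C\<close>. The complement of such a translate is the image of the meagre set
  \<open>carrier G - C\<close> under a left translation, which is a homeomorphism; countably many
  meagre sets leave a point uncovered.\<close>

lemma comeagre_translates_meet: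
  assumes "completely_metrizable_space T" "comeagre_in T C" "countable A" "A \<subseteq> carrier G"
  shows "\<exists>c \<in> carrier G. \<forall>a\<in>A. a \<otimes> c \<in> C"
proof -
  define M where "M a = (\<lambda>x. inv a \<otimes> x) ` (carrier G - C)" for a
  have "meagre_in T (M a)" if "a \<in> A" for a
    using homeomorphic_map_meagre_in[OF homeomorphic_map_left_mult] assms that
    unfolding M_def comeagre_in_def topspace_eq_carrier by blast
  moreover have "topspace T \<noteq> {}"
    using topspace_eq_carrier by auto
  ultimately obtain c where c: "c \<in> carrier G" "\<forall>a\<in>A. c \<notin> M a"
    using countable_meagre_avoid_point[OF assms(1,3)] topspace_eq_carrier by metis
  have "a \<otimes> c \<in> C" if "a \<in> A" for a
  proof (rule ccontr)
    have a: "a \<in> carrier G"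
      using that assms(4) by blast
    assume "a \<otimes> c \<notin> C"
    with a c have "inv a \<otimes> (a \<otimes> c) \<in> M a"
      unfolding M_def by blast
    then show False
      using a c that by (simp add: m_assoc[symmetric])
  qed
  then show ?thesis
    using c by blast
qed

end

lemma hom_set_power_subset:
  assumes \<phi>: "\<phi> \<in> hom G H" and "group G" "group H" and "W \<subseteq> carrier G" "\<phi> ` W \<subseteq> K"
  shows "\<phi> ` set_power G W k \<subseteq> set_power H K k"
proof -
  interpret group_hom G H \<phi>
    using assms by (simp add: group_hom_def group_hom_axioms_def)
  show ?thesis
  proof (induction k)
    case (Suc k)
    have "set_power G W k \<subseteq> carrier G"
      using assms(4) by (induction k) (auto dest: subsetD[OF G.set_mult_closed])
    then show ?case
      using Suc assms(4,5) unfolding set_power.simps set_mult_def by fastforce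
  qed simp
qed

text \<open>Pulling a compact exhaustion of \<open>H\<close> back along \<phi> gives an exhaustion
  of \<open>G\<close>. Bergman's property writes \<open>G\<close> as a power of one stage, so the
  image lies in the same power of a compact set.\<close>

lemma bergman_hom_image_in_compact:
  assumes "group G" "bergman_property G"
    and "topological_group H T" "sigma_compact_space T" "\<phi> \<in> hom G H"
  shows "\<exists>L. compactin T L \<and> \<phi> ` carrier G \<subseteq> L"
proof -
  interpret H: topological_group H T
    by fact
  obtain K where K: "\<And>n::nat. compactin T (K n)" "(\<Union>n. K n) = topspace T"
    using assms(4) unfolding sigma_compact_space_def by blast
  \<comment> \<open>The sets \<open>K n\<close> need not increase, as Bergman's property demands;
    their finite unions do, and stay compact.\<close>
  define U where "U n = \<Union> (K ` {..n})" for n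
  define W where "W n = {g \<in> carrier G. \<phi> g \<in> U n}" for n
  have "W n \<subseteq> W (Suc n)" for n
    unfolding W_def U_def by (auto simp: atMost_Suc)
  moreover have "(\<Union>n. W n) = carrier G"
    using K(2) hom_in_carrier[OF assms(5)] H.topspace_eq_carrier
    unfolding W_def U_def by fastforce
  ultimately obtain n k where "carrier G = set_power G (W n) k"
    using assms(2) unfolding bergman_property_def by blast
  then have "\<phi> ` carrier G \<subseteq> set_power H (U n) k"
    using hom_set_power_subset[OF assms(5,1) H.is_group, of "W n" "U n" k] unfolding W_def by auto
  moreover have "compactin T (set_power H (U n) k)"
    unfolding U_def using K(1) by (intro H.compactin_set_power compactin_Union) auto
  ultimately show ?thesis
    by blast
qed

theorem mainTheorem9:
  fixes G :: "('a, 'm) monoid_scheme" and S :: "'a topology"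
    and H :: "('b, 'n) monoid_scheme" and T :: "'b topology"
    and \<phi> :: "'a \<Rightarrow> 'b"
  assumes "topological_group G S" and "polish_topology S"
    and "bergman_property G"
    and "\<exists>x \<in> carrier G. comeagre_in S (conjugacy_class G x)"
    and "topological_group H T" and "Hausdorff_space T"
    and "locally_compact_space T" and "sigma_compact_space T"
    and "\<phi> \<in> hom G H"
  shows "\<forall>g \<in> carrier G. \<phi> g = \<one>\<^bsub>H\<^esub>"
proof -
  interpret G: topological_group G S
    by fact
  interpret H: topological_group H T
    by fact
  interpret group_hom G H \<phi>
    using assms(9) G.is_group H.is_group by (simp add: group_hom_def group_hom_axioms_def)
  obtain x where x: "x \<in> carrier G" and C: "comeagre_in S (conjugacy_class G x)"
    using assms(4) by blast
  define R where "R = \<phi> ` carrier G"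
  define L where "L = T closure_of R"
  have R: "R \<subseteq> topspace T"
    unfolding R_def H.topspace_eq_carrier by auto
  then have RL: "R \<subseteq> L"
    unfolding L_def by (simp add: closure_of_subset)
  have Lc: "L \<subseteq> carrier H"
    unfolding L_def using closure_of_subset_topspace[of T R] H.topspace_eq_carrier by blast
  obtain B where B: "compactin T B" "R \<subseteq> B"
    using bergman_hom_image_in_compact[OF G.is_group assms(3,5,8,9)] by (auto simp: R_def)
  \<comment> \<open>In a Hausdorff space the compact set \<open>B\<close> is closed, so it contains
    the closure of \<open>R\<close>.\<close>
  have "L \<subseteq> B"
    unfolding L_def using B compactin_imp_closedin[OF assms(6)] by (simp add: closure_of_minimal)
  then have L: "compactin T L"
    unfolding L_def using closed_compactin[OF B(1)] by simp
  define K where "K = (\<lambda>h. h \<otimes>\<^bsub>H\<^esub> \<phi> x \<otimes>\<^bsub>H\<^esub> inv\<^bsub>H\<^esub> h) ` L"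
  have "continuous_map T T (\<lambda>h. h \<otimes>\<^bsub>H\<^esub> \<phi> x \<otimes>\<^bsub>H\<^esub> inv\<^bsub>H\<^esub> h)"
    using x by (intro H.continuous_map_mult H.continuous_map_inv) (auto simp: H.topspace_eq_carrier)
  then have "compactin T K"
    unfolding K_def by (rule image_compactin[OF L])
  then have K: "closedin T K"
    by (simp add: assms(6) compactin_imp_closedin)
  have \<phi>C: "\<phi> ` conjugacy_class G x \<subseteq> K"
    using x RL unfolding conjugacy_class_def K_def R_def by fastforce
  \<comment> \<open>\<open>D g\<close> is the translate of \<open>K\<close> by the inverse of
    \<open>\<phi> g\<close>. A common point of all of them cannot come from the category argument
    directly, since \<open>G\<close> may be uncountable; finite subfamilies meet in
    \<open>L\<close>, and compactness does the rest.\<close>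
  define D where "D g = {h \<in> topspace T. \<phi> g \<otimes>\<^bsub>H\<^esub> h \<in> K}" for g
  have "\<exists>c\<in>L. \<forall>g\<in>carrier G. c \<in> D g"
  proof (rule compactin_fip_indexed[OF L])
    show "closedin T (D g)" if "g \<in> carrier G" for g
      unfolding D_def using that
      by (intro closedin_continuous_map_preimage[OF _ K] continuous_intros)
        (auto simp: H.topspace_eq_carrier)
    show "\<exists>c\<in>L. \<forall>g\<in>A. c \<in> D g" if A: "finite A" "A \<subseteq> carrier G" for A
    proof -
      obtain c where c: "c \<in> carrier G" "\<forall>g\<in>A. g \<otimes>\<^bsub>G\<^esub> c \<in> conjugacy_class G x"
        using G.comeagre_translates_meet[OF _ C countable_finite[OF A(1)] A(2)] assms(2)
        unfolding polish_topology_def by blast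
      have "\<phi> c \<in> D g" if "g \<in> A" for g
      proof -
        have "\<phi> (g \<otimes>\<^bsub>G\<^esub> c) \<in> K"
          using \<phi>C c that by blast
        moreover have "g \<in> carrier G"
          using A(2) that by blast
        ultimately show ?thesis
          using c(1) by (simp add: D_def H.topspace_eq_carrier)
      qed
      moreover have "\<phi> c \<in> L"
        using c(1) RL R_def by blast
      ultimately show ?thesis
        by blast
    qed
  qed
  then obtain c where c: "c \<in> L" and \<phi>cK: "\<And>g. g \<in> carrier G \<Longrightarrow> \<phi> g \<otimes>\<^bsub>H\<^esub> c \<in> K"
    unfolding D_def by blast
  have cH: "c \<in> carrier H"
    using c Lc by blast
  \<comment> \<open>Right translation by \<open>c\<close> is continuous and \<open>K\<close> is
    closed, so the inclusion of \<open>R c\<close> in \<open>K\<close> extends to the closure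
    \<open>L\<close> of \<open>R\<close>.\<close>
  have "closedin T {h \<in> topspace T. h \<otimes>\<^bsub>H\<^esub> c \<in> K}"
    using cH by (intro closedin_continuous_map_preimage[OF _ K] continuous_intros)
      (auto simp: H.topspace_eq_carrier)
  moreover have "R \<subseteq> {h \<in> topspace T. h \<otimes>\<^bsub>H\<^esub> c \<in> K}"
    using \<phi>cK R unfolding R_def by blast
  ultimately have LcK: "L \<subseteq> {h \<in> topspace T. h \<otimes>\<^bsub>H\<^esub> c \<in> K}"
    unfolding L_def by (rule closure_of_minimal[rotated])
  \<comment> \<open>The point \<open>c\<close> need not lie in \<open>R\<close>. As \<open>R\<close>
    is closed under inverses and inversion is continuous, so is its closure \<open>L\<close>; then
    the inverse of \<open>c\<close> may be put for \<open>h\<close> in \<open>LcK\<close>.\<close>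
  have "(\<lambda>h. inv\<^bsub>H\<^esub> h) ` R \<subseteq> R"
  proof clarify
    fix h assume "h \<in> R"
    then obtain g where "g \<in> carrier G" "h = \<phi> g"
      unfolding R_def by blast
    then show "inv\<^bsub>H\<^esub> h \<in> R"
      unfolding R_def by (metis G.inv_closed hom_inv imageI)
  qed
  then have "inv\<^bsub>H\<^esub> c \<in> L"
    using continuous_map_image_closure_subset[OF H.continuous_inv, of R] c closure_of_mono
    unfolding L_def by blast
  then have "\<one>\<^bsub>H\<^esub> \<in> K"
    using LcK cH by force
  then obtain h where h: "h \<in> L" and hx: "h \<otimes>\<^bsub>H\<^esub> \<phi> x \<otimes>\<^bsub>H\<^esub> inv\<^bsub>H\<^esub> h = \<one>\<^bsub>H\<^esub>"
    unfolding K_def by force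
  have hH: "h \<in> carrier H"
    using h Lc by blast
  \<comment> \<open>By \<open>hx\<close>, the element \<open>h \<phi>(x)\<close> is a left inverse
    of the inverse of \<open>h\<close>, hence equals \<open>h\<close>.\<close>
  then have "h \<otimes>\<^bsub>H\<^esub> \<phi> x = h"
    using H.inv_equality[OF hx] x by (metis H.inv_closed H.inv_inv H.m_closed hom_closed)
  then have "\<phi> x = \<one>\<^bsub>H\<^esub>"
    using hH x by simp
  \<comment> \<open>All elements of \<open>K\<close> are conjugates of \<open>\<phi> x\<close>,
    which is now the identity.\<close>
  then have "K \<subseteq> {\<one>\<^bsub>H\<^esub>}"
    unfolding K_def using Lc by auto
  then have \<phi>c: "\<phi> g \<otimes>\<^bsub>H\<^esub> c = \<one>\<^bsub>H\<^esub>" if "g \<in> carrier G" for g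
    using \<phi>cK[OF that] by blast
  have "c = \<one>\<^bsub>H\<^esub>"
    using \<phi>c[OF G.one_closed] cH by simp
  then show ?thesis
    using \<phi>c by simp
qed

end
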